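(* Let $\{W_j\}_{j\in J}$ be a family of closed subspaces of $\mathcal{H}$. Then the following statements are equivalent: (i) $\{W_j\}_{j\in J}$ is a Riesz $f$-basis for $\mathcal{H}$. (ii) There is an equivalent inner product on $\mathcal{H}$ with respect to which the sequence $\{W_j\}_{j\in J}$ becomes an orthonormal $f$-basis for $\mathcal{H}$. (iii) The family $\{W_j\}_{j\in J}$ is complete for $\mathcal{H}$ and there exist positive constants $A,B$ such that for any finite subset $F\subset J$ and arbitrary vectors $g_j\in W_j$, $$A\sum_{j\in F}\|g_j\|^2\leq\Big\|\sum_{j\in F}g_j\Big\|^2\leq B\sum_{j\in F}\|g_j\|^2.$$
   Context: $\mathcal{H}$ is a separable Hilbert space, $J$ is a countable (or finite) index set, and $\pi_W$ denotes the orthogonal projection onto a closed subspace $W$. A sequence $\{W_j\}_{j\in J}$ of closed subspaces is complete for $\mathcal{H}$ if $\mathcal{H}=\overline{\operatorname{span}}\{W_j\}_{j\in J}$. A sequence $\{V_j\}_{j\in J}$ of closed subspaces is an orthonormal $f$-system if $\pi_{V_i}g_j=\delta_{ij}g_j$ for all $i,j\in J$, $g_j\in V_j$, and an orthonormal $f$-basis if it is moreover complete (with respect to another inner product, orthogonal projections are taken with respect to that inner product). $\{W_j\}_{j\in J}$ is a Riesz $f$-basis (Riesz fusion basis) for $\mathcal{H}$ if there exist an orthonormal $f$-basis $\{V_j\}_{j\in J}$ for $\mathcal{H}$ and a bounded invertible linear operator $T$ on $\mathcal{H}$ such that $TV_j=W_j$ for all $j\in J$. An inner product on $\mathcal{H}$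 is equivalent to the original one if the norm $\|\cdot\|_1$ it induces satisfies $m\|f\|\le\|f\|_1\le M\|f\|$ for all $f\in\mathcal{H}$, for some constants $m,M>0$. *)

theory Defs
  imports "HOL-Analysis.Analysis"
begin

text \<open>
  A Hilbert space may be real or complex. Both scalar fields are treated at once by the following
  class: by the Gelfand--Mazur theorem every real normed field is (isometrically) the reals or the
  complex numbers, and the last axiom then forces \<open>conjugate\<close> to be the usual conjugation.
\<close>

class real_or_complex = real_normed_field +
  fixes conjugate :: "'a \<Rightarrow> 'a"
  assumes conjugate_add: "conjugate (x + y) = conjugate x + conjugate y"
    and conjugate_mult: "conjugate (x * y) = conjugate x * conjugate y"
    and conjugate_conjugate: "conjugate (conjugate x) = x"
    and mult_conjugate: "x * conjugate x = (norm x)\<^sup>2 *\<^sub>R 1"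

instantiation real :: real_or_complex
begin
definition conjugate_real :: "real \<Rightarrow> real" where "conjugate_real x = x"
instance by standard (simp_all add: conjugate_real_def power2_eq_square)
end

instantiation complex :: real_or_complex
begin
definition conjugate_complex :: "complex \<Rightarrow> complex" where "conjugate_complex = cnj"
instance
  by standard
    (simp_all add: conjugate_complex_def scaleR_conv_of_real flip: complex_norm_square)
end

text \<open>
  Inner products are functions rather than class operations, since one space carries several of
  them. They are linear in the first argument.
\<close>

definition inner_product ::
    "('k::real_or_complex \<Rightarrow> 'a::ab_group_add \<Rightarrow> 'a) \<Rightarrow> ('a \<Rightarrow> 'a \<Rightarrow> 'k) \<Rightarrow> bool" where
  "inner_product smul ip \<longleftrightarrow>
     (\<forall>x y z. ip (x + y) z = ip x z + ip y z) \<and>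
     (\<forall>c x y. ip (smul c x) y = c * ip x y) \<and>
     (\<forall>x y. ip y x = conjugate (ip x y)) \<and>
     (\<forall>x. x \<noteq> 0 \<longrightarrow> (\<exists>r>0. ip x x = of_real r))"

definition ip_norm :: "('a \<Rightarrow> 'a \<Rightarrow> 'k::real_or_complex) \<Rightarrow> 'a \<Rightarrow> real" where
  "ip_norm ip x = sqrt (norm (ip x x))"

text \<open>The norm (hence topology and completeness) of the space is that of the class \<open>banach\<close>.\<close>

locale separable_hilbert_space = vector_space smul
  for smul :: "'k::real_or_complex \<Rightarrow> 'a::banach \<Rightarrow> 'a" +
  fixes ip :: "'a \<Rightarrow> 'a \<Rightarrow> 'k"
  assumes scale_of_real: "smul (of_real r) x = r *\<^sub>R x"
    and inner_product: "inner_product smul ip"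
    and norm_eq_ip_norm: "norm x = ip_norm ip x"
    and separable: "separable_space (euclidean :: 'a topology)"

lemma separable_hilbert_space_real_inner:
  assumes "separable_space (euclidean :: 'a::{real_inner, banach} topology)"
  shows "separable_hilbert_space scaleR (inner :: 'a \<Rightarrow> 'a \<Rightarrow> real)"
  by unfold_locales
    (auto simp: inner_product_def ip_norm_def conjugate_real_def inner_add_left inner_commute
      norm_eq_sqrt_inner assms algebra_simps)

lemma separable_hilbert_space_complex:
  "separable_hilbert_space ((*) :: complex \<Rightarrow> complex \<Rightarrow> complex) (\<lambda>x y. x * cnj y)"
proof unfold_locales
  have "\<exists>r>0. x * cnj x = complex_of_real r" if "x \<noteq> 0" for x
    using that by (intro exI[of _ "(cmod x)\<^sup>2"]) (simp flip: complex_norm_square)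
  then show "inner_product (*) (\<lambda>x y :: complex. x * cnj y)"
    by (simp add: inner_product_def conjugate_complex_def algebra_simps)
  obtain D :: "complex set" where "countable D" "closure D = UNIV"
    using separable[of "UNIV :: complex set"] by (metis top.extremum_uniqueI)
  then show "separable_space (euclidean :: complex topology)"
    by (auto simp: separable_space_def)
qed (simp_all add: algebra_simps scaleR_conv_of_real ip_norm_def norm_mult)

definition closed_subspace ::
    "('k::real_or_complex \<Rightarrow> 'a::real_normed_vector \<Rightarrow> 'a) \<Rightarrow> 'a set \<Rightarrow> bool" where
  "closed_subspace smul W \<longleftrightarrow> module.subspace smul W \<and> closed W"

definition complete_family ::
    "('k::real_or_complex \<Rightarrow> 'a::real_normed_vector \<Rightarrow> 'a) \<Rightarrow> 'i set \<Rightarrow> ('i \<Rightarrow> 'a set) \<Rightarrow> bool" where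
  "complete_family smul J W \<longleftrightarrow> closure (module.span smul (\<Union>j\<in>J. W j)) = UNIV"

definition orth_proj ::
    "('a \<Rightarrow> 'a \<Rightarrow> 'k::real_or_complex) \<Rightarrow> 'a::ab_group_add set \<Rightarrow> 'a \<Rightarrow> 'a" where
  "orth_proj ip W x = (THE y. y \<in> W \<and> (\<forall>w\<in>W. ip (x - y) w = 0))"

definition orthonormal_f_system ::
    "('k::real_or_complex \<Rightarrow> 'a::real_normed_vector \<Rightarrow> 'a) \<Rightarrow> ('a \<Rightarrow> 'a \<Rightarrow> 'k) \<Rightarrow>
     'i set \<Rightarrow> ('i \<Rightarrow> 'a set) \<Rightarrow> bool" where
  "orthonormal_f_system smul ip J V \<longleftrightarrow>
     (\<forall>j\<in>J. closed_subspace smul (V j)) \<and>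
     (\<forall>i\<in>J. \<forall>j\<in>J. \<forall>g\<in>V j. orth_proj ip (V i) g = (if i = j then g else 0))"

text \<open>
  The inner product \<open>ip\<close> below need not be the original one. Closures are taken in the topology of
  the space, which is also that of any equivalent inner product.
\<close>

definition orthonormal_f_basis ::
    "('k::real_or_complex \<Rightarrow> 'a::real_normed_vector \<Rightarrow> 'a) \<Rightarrow> ('a \<Rightarrow> 'a \<Rightarrow> 'k) \<Rightarrow>
     'i set \<Rightarrow> ('i \<Rightarrow> 'a set) \<Rightarrow> bool" where
  "orthonormal_f_basis smul ip J V \<longleftrightarrow>
     orthonormal_f_system smul ip J V \<and> complete_family smul J V"

definition bounded_operator ::
    "('k::real_or_complex \<Rightarrow> 'a::real_normed_vector \<Rightarrow> 'a) \<Rightarrow> ('a \<Rightarrow> 'a) \<Rightarrow> bool" where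
  "bounded_operator smul T \<longleftrightarrow> Vector_Spaces.linear smul smul T \<and> bounded_linear T"

text \<open>Invertibility is meant in the algebra of bounded operators.\<close>

definition bounded_invertible_operator ::
    "('k::real_or_complex \<Rightarrow> 'a::real_normed_vector \<Rightarrow> 'a) \<Rightarrow> ('a \<Rightarrow> 'a) \<Rightarrow> bool" where
  "bounded_invertible_operator smul T \<longleftrightarrow>
     bounded_operator smul T \<and>
     (\<exists>S. bounded_operator smul S \<and> S \<circ> T = id \<and> T \<circ> S = id)"

definition riesz_f_basis ::
    "('k::real_or_complex \<Rightarrow> 'a::real_normed_vector \<Rightarrow> 'a) \<Rightarrow> ('a \<Rightarrow> 'a \<Rightarrow> 'k) \<Rightarrow>
     'i set \<Rightarrow> ('i \<Rightarrow> 'a set) \<Rightarrow> bool" where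
  "riesz_f_basis smul ip J W \<longleftrightarrow>
     (\<exists>V T. orthonormal_f_basis smul ip J V \<and> bounded_invertible_operator smul T \<and>
        (\<forall>j\<in>J. T ` V j = W j))"

definition equivalent_inner_product ::
    "('k::real_or_complex \<Rightarrow> 'a::real_normed_vector \<Rightarrow> 'a) \<Rightarrow> ('a \<Rightarrow> 'a \<Rightarrow> 'k) \<Rightarrow> bool" where
  "equivalent_inner_product smul ip1 \<longleftrightarrow>
     inner_product smul ip1 \<and>
     (\<exists>m>0. \<exists>M>0. \<forall>f. m * norm f \<le> ip_norm ip1 f \<and> ip_norm ip1 f \<le> M * norm f)"

end

theory Submission
  imports Defs
begin

text \<open>
  (i) to (ii): pull the inner product back along the inverse of \<open>T\<close>. (ii) to (iii): with respect to
  the new inner product the \<open>W j\<close> are mutually orthogonal, so Pythagoras and the equivalence of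
  norms give both bounds.

  (iii) to (i): let \<open>p j\<close> be the orthogonal projection onto \<open>W j\<close>. The upper bound makes the frame
  operator \<open>S x = (\<Sum>j. p j x)\<close> converge unconditionally, and the lower bound together with
  completeness gives \<open>A * norm x ^ 2 \<le> \<langle>S x, x\<rangle>\<close>. Hence \<open>S = R * R\<close> with \<open>R\<close> self-adjoint and
  invertible. If \<open>S z = g\<close> with \<open>g\<close> in \<open>W i\<close>, uniqueness of expansions forces \<open>p j z = 0\<close> for
  \<open>j \<noteq> i\<close>; therefore the subspaces \<open>R\<inverse> (W j)\<close> are mutually orthogonal, and \<open>R\<close> maps them onto
  the \<open>W j\<close>.
\<close>

section \<open>Inner products equivalent to the norm\<close>

text \<open>For nonzero \<open>r\<close> the axiom \<open>mult_conjugate\<close> determines the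
  value after cancelling \<open>of_real r\<close>; at zero nothing can be cancelled and additivity
  of \<open>conjugate\<close> decides.\<close>

lemma conjugate_of_real: "conjugate (of_real r :: 'k::real_or_complex) = of_real r"
proof (cases "r = 0")
  case True
  have "conjugate (0::'k) + conjugate 0 = conjugate 0"
    by (metis add_0 conjugate_add)
  then show ?thesis using True by simp
next
  case False
  have "of_real r * conjugate (of_real r :: 'k) = of_real r * of_real r"
    using mult_conjugate[of "of_real r :: 'k"]
    by (simp add: scaleR_conv_of_real power2_eq_square)
  then show ?thesis using False by simp
qed

text \<open>\<open>real_part z\<close> is read off from \<open>norm (1 + z)\<^sup>2 = 1 + 2 Re z + norm z\<^sup>2\<close>, since the class
  provides no real part.\<close>

definition real_part :: "'k::real_or_complex \<Rightarrow> real" where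
  "real_part z = ((norm (1 + z))\<^sup>2 - 1 - (norm z)\<^sup>2) / 2"

lemma add_conjugate: "z + conjugate z = 2 * of_real (real_part (z :: 'k::real_or_complex))"
proof -
  have "1 + z + conjugate z + z * conjugate z = (1 + z) * conjugate (1 + z)"
    using conjugate_of_real[of 1, where 'k='k] by (simp add: conjugate_add algebra_simps)
  then have "z + conjugate z = of_real ((norm (1 + z))\<^sup>2) - 1 - of_real ((norm z)\<^sup>2)"
    unfolding mult_conjugate by (simp add: scaleR_conv_of_real algebra_simps)
  also have "\<dots> = of_real (2 * real_part z)"
    by (simp add: real_part_def)
  finally show ?thesis by simp
qed

text \<open>Characterises \<open>real_part\<close> by a linear equation, so that its algebraic laws
  can be checked without touching the quadratic definition.\<close>

lemma real_part_unique: "z + conjugate z = 2 * of_real r \<Longrightarrow> real_part z = r"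
  by (simp add: add_conjugate)

lemma real_part_add: "real_part (x + y) = real_part x + real_part y"
proof (rule real_part_unique)
  have "x + y + conjugate (x + y) = (x + conjugate x) + (y + conjugate y)"
    by (simp add: conjugate_add)
  then show "x + y + conjugate (x + y) = 2 * of_real (real_part x + real_part y)"
    by (simp add: add_conjugate distrib_left)
qed

lemma real_part_of_real_mult: "real_part (of_real r * x) = r * real_part x"
proof (rule real_part_unique)
  have "of_real r * x + conjugate (of_real r * x) = of_real r * (x + conjugate x)"
    by (simp add: conjugate_mult conjugate_of_real distrib_left)
  then show "of_real r * x + conjugate (of_real r * x) = 2 * of_real (r * real_part x)"
    by (simp add: add_conjugate)
qed

lemma real_part_of_real [simp]: "real_part (of_real r) = r"
  by (rule real_part_unique) (simp add: conjugate_of_real)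

lemma real_part_conjugate: "real_part (conjugate z) = real_part z"
  by (rule real_part_unique) (metis add.commute add_conjugate conjugate_conjugate)

text \<open>Separates the inner product from the norm of the class: the results apply both to the
  original inner product and to the one of statement (ii), with one fixed topology.\<close>

locale equivalent_ip = vector_space smul
  for smul :: "'k::real_or_complex \<Rightarrow> 'a::banach \<Rightarrow> 'a" +
  fixes ip :: "'a \<Rightarrow> 'a \<Rightarrow> 'k"
  assumes scale_of_real: "smul (of_real r) x = r *\<^sub>R x"
    and equivalent: "equivalent_inner_product smul ip"
begin

text \<open>The underlying real inner product. It induces the same norm as \<open>ip\<close>, and
  its values are ordered, so that estimates and minimisation can be carried out over the
  reals.\<close>

definition rip :: "'a \<Rightarrow> 'a \<Rightarrow> real" where
  "rip x y = real_part (ip x y)"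

lemma ip_add_left: "ip (x + y) z = ip x z + ip y z"
  and ip_smul_left: "ip (smul c x) y = c * ip x y"
  and ip_commute: "ip y x = conjugate (ip x y)"
  using equivalent unfolding equivalent_inner_product_def inner_product_def by blast+

lemma ip_zero_left [simp]: "ip 0 x = 0"
  using ip_add_left[of 0 0 x] by simp

lemma ip_zero_right [simp]: "ip x 0 = 0"
  using ip_commute[of x 0] conjugate_of_real[of 0, where 'k='k] by simp

lemma rip_commute: "rip x y = rip y x"
  unfolding rip_def by (metis ip_commute real_part_conjugate)

lemma rip_add_left: "rip (x + y) z = rip x z + rip y z"
  by (simp add: rip_def ip_add_left real_part_add)

lemma rip_scaleR_left: "rip (r *\<^sub>R x) y = r * rip x y"
  by (simp add: rip_def ip_smul_left real_part_of_real_mult flip: scale_of_real)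

lemma ip_self: "ip x x = of_real (rip x x)"
  using equivalent unfolding equivalent_inner_product_def inner_product_def rip_def
  by (metis ip_zero_left of_real_0 real_part_of_real)

lemma rip_pos: "x \<noteq> 0 \<Longrightarrow> 0 < rip x x"
  using equivalent unfolding equivalent_inner_product_def inner_product_def rip_def
  by (metis real_part_of_real)

lemma rip_zero_left [simp]: "rip 0 x = 0"
  by (metis rip_scaleR_left scaleR_zero_left mult_zero_left)

lemma rip_nonneg: "0 \<le> rip x x"
  by (metis order_less_imp_le order_refl rip_pos rip_zero_left)

lemma ip_norm_eq: "ip_norm ip x = sqrt (rip x x)"
  unfolding ip_norm_def ip_self by (simp add: rip_nonneg)

lemma ip_norm_sq: "(ip_norm ip x)\<^sup>2 = rip x x"
  unfolding ip_norm_eq by (simp add: rip_nonneg)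

lemma norm_bounds:
  obtains m M where "m > 0" "M > 0"
    "\<And>x. m * (norm x)\<^sup>2 \<le> rip x x" "\<And>x. rip x x \<le> M * (norm x)\<^sup>2"
proof -
  obtain m M where *: "m > 0" "M > 0"
    "\<And>x. m * norm x \<le> ip_norm ip x" "\<And>x. ip_norm ip x \<le> M * norm x"
    using equivalent unfolding equivalent_inner_product_def by blast
  have "m\<^sup>2 * (norm x)\<^sup>2 \<le> rip x x" "rip x x \<le> M\<^sup>2 * (norm x)\<^sup>2" for x
    using power_mono[OF *(3), of x 2] power_mono[OF *(4), of x 2] *(1)
    by (auto simp: ip_norm_sq power_mult_distrib) (simp add: ip_norm_eq rip_nonneg)
  then show ?thesis using that[of "m\<^sup>2" "M\<^sup>2"] * by simp
qed

lemma rip_add_right: "rip z (x + y) = rip z x + rip z y"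
  by (metis rip_add_left rip_commute)

lemma rip_scaleR_right: "rip y (r *\<^sub>R x) = r * rip y x"
  by (metis rip_scaleR_left rip_commute)

text \<open>The quadratic in \<open>t\<close> behind Cauchy-Schwarz, behind the variational
  characterisation of projections and behind the norm estimate for \<open>Q\<close> in
  \<open>sqrt_operator\<close>.\<close>

lemma rip_square_expand:
  "rip (x + t *\<^sub>R y) (x + t *\<^sub>R y) = rip x x + 2 * t * rip x y + t\<^sup>2 * rip y y"
  by (simp add: rip_add_left rip_add_right rip_scaleR_left rip_scaleR_right rip_commute[of y x]
      power2_eq_square algebra_simps)

lemma rip_Cauchy_Schwarz: "\<bar>rip x y\<bar> \<le> ip_norm ip x * ip_norm ip y"
proof (cases "y = 0")
  case True
  then show ?thesis using rip_commute[of x 0] by (simp add: ip_norm_eq)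
next
  case False
  then have p: "rip y y > 0" by (rule rip_pos)
  \<comment> \<open>The coefficient \<open>- rip x y / rip y y\<close> is the minimiser of the
    quadratic in \<open>t\<close>.\<close>
  have "0 \<le> rip x x + 2 * (- rip x y / rip y y) * rip x y + (- rip x y / rip y y)\<^sup>2 * rip y y"
    unfolding rip_square_expand[symmetric] by (rule rip_nonneg)
  also have "\<dots> = rip x x - (rip x y)\<^sup>2 / rip y y"
    using p by (simp add: field_simps power2_eq_square)
  finally have "(rip x y)\<^sup>2 \<le> rip x x * rip y y"
    using p by (simp add: field_simps)
  then show ?thesis
    unfolding ip_norm_eq real_sqrt_mult[symmetric] by (metis real_sqrt_abs real_sqrt_le_mono)
qed

text \<open>Cauchy-Schwarz followed by the equivalence of norms bounds \<open>rip\<close> in terms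
  of the class norm, which makes it continuous in the topology of the space.\<close>

lemma bounded_bilinear_rip: "bounded_bilinear rip"
proof -
  obtain M where M: "\<And>x. ip_norm ip x \<le> M * norm x"
    using equivalent unfolding equivalent_inner_product_def by blast
  have "\<bar>rip x y\<bar> \<le> norm x * norm y * (M * M)" for x y
  proof -
    have "\<bar>rip x y\<bar> \<le> ip_norm ip x * ip_norm ip y" by (rule rip_Cauchy_Schwarz)
    also have "\<dots> \<le> (M * norm x) * (M * norm y)"
      by (intro mult_mono' M) (auto simp: ip_norm_eq rip_nonneg)
    finally show ?thesis by (simp add: mult_ac)
  qed
  then show ?thesis
    by unfold_locales (auto simp: rip_add_left rip_add_right rip_scaleR_left rip_scaleR_right)
qed

sublocale rip: bounded_bilinear rip
  by (rule bounded_bilinear_rip)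

lemma ip_diff_left: "ip (x - y) z = ip x z - ip y z"
  by (metis add_diff_cancel_right' diff_add_cancel ip_add_left)

text \<open>Scaling \<open>w\<close> by \<open>conjugate (ip w x)\<close> turns \<open>ip w x\<close> into the real number \<open>norm (ip w x)\<^sup>2\<close>.\<close>

lemma ip_eq_0_if_rip_eq_0:
  assumes W: "subspace W" "w \<in> W" and rip: "\<And>w. w \<in> W \<Longrightarrow> rip x w = 0"
  shows "ip x w = 0"
proof -
  have "ip w x * conjugate (ip w x) = ip (smul (conjugate (ip w x)) w) x"
    by (simp add: ip_smul_left mult.commute)
  then have "real_part (of_real ((norm (ip w x))\<^sup>2) :: 'k) = rip (smul (conjugate (ip w x)) w) x"
    unfolding mult_conjugate rip_def by (simp add: scaleR_conv_of_real)
  also have "\<dots> = 0"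
    using rip[OF subspace_scale[OF W]] by (subst rip_commute)
  finally have "ip w x = 0" by (simp del: of_real_power)
  then show ?thesis
    using ip_commute[of x w] conjugate_of_real[of 0, where 'k='k] by simp
qed

lemma smul_scaleR: "smul c (r *\<^sub>R x) = r *\<^sub>R smul c x"
  by (simp add: mult.commute flip: scale_of_real)

text \<open>The axioms relate \<open>smul\<close> to the class norm only for real scalars. With
  respect to \<open>ip\<close> the norm scales exactly by \<open>norm c\<close>, and equivalence of
  norms transfers this up to the factor \<open>sqrt (M / m)\<close>.\<close>

lemma bounded_linear_smul: "bounded_linear (smul c)"
proof -
  obtain m M where b: "m > 0" "M > 0"
    "\<And>x. m * (norm x)\<^sup>2 \<le> rip x x" "\<And>x. rip x x \<le> M * (norm x)\<^sup>2"
    by (rule norm_bounds) blast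
  have eq: "rip (smul c x) (smul c x) = (norm c)\<^sup>2 * rip x x" for x
  proof -
    have "ip x (smul c x) = conjugate c * of_real (rip x x)"
      by (subst ip_commute) (simp add: ip_smul_left conjugate_mult ip_self conjugate_of_real)
    then have "ip (smul c x) (smul c x) = c * conjugate c * of_real (rip x x)"
      by (simp only: ip_smul_left mult.assoc)
    then have "of_real (rip (smul c x) (smul c x)) = (of_real ((norm c)\<^sup>2 * rip x x) :: 'k)"
      unfolding mult_conjugate ip_self by (simp add: scaleR_conv_of_real)
    then show ?thesis by (simp only: of_real_eq_iff)
  qed
  show ?thesis
  proof (rule bounded_linear_intro)
    show "smul c (x + y) = smul c x + smul c y" for x y by (rule scale_right_distrib)
    show "smul c (r *\<^sub>R x) = r *\<^sub>R smul c x" for r x by (rule smul_scaleR)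
    fix x
    have "m * (norm (smul c x))\<^sup>2 \<le> (norm c)\<^sup>2 * (M * (norm x)\<^sup>2)"
      using b(3)[of "smul c x"] mult_left_mono[OF b(4)[of x], of "(norm c)\<^sup>2"] by (simp add: eq)
    then have "(norm (smul c x))\<^sup>2 \<le> (norm x * (norm c * sqrt (M / m)))\<^sup>2"
      using b by (simp add: field_simps power_mult_distrib)
    then show "norm (smul c x) \<le> norm x * (norm c * sqrt (M / m))"
      by (rule power2_le_imp_le) (use b in simp)
  qed
qed

section \<open>Orthogonal projections and orthonormal systems\<close>

text \<open>A sequence in \<open>W\<close> minimising the \<open>rip\<close> distance to
  \<open>x\<close> is Cauchy by the parallelogram law; its limit is the foot of the
  perpendicular.\<close>

lemma projection_exists:
  assumes W: "subspace W" "closed W"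
  shows "\<exists>y\<in>W. \<forall>w\<in>W. ip (x - y) w = 0"
proof -
  obtain m M where b: "m > 0" "M > 0"
    "\<And>x. m * (norm x)\<^sup>2 \<le> rip x x" "\<And>x. rip x x \<le> M * (norm x)\<^sup>2"
    by (rule norm_bounds) blast
  define d where "d = (INF w\<in>W. rip (x - w) (x - w))"
  have ne: "W \<noteq> {}" using subspace_0[OF W(1)] by blast
  have bdd: "bdd_below ((\<lambda>w. rip (x - w) (x - w)) ` W)"
    by (rule bdd_belowI2[of _ 0]) (rule rip_nonneg)
  have d_le: "d \<le> rip (x - w) (x - w)" if "w \<in> W" for w
    unfolding d_def by (rule cINF_lower[OF bdd that])
  have "\<exists>w\<in>W. rip (x - w) (x - w) < d + 1 / (real n + 1)" for n
    using cINF_less_iff[OF ne bdd, of "d + 1 / (real n + 1)"] by (simp add: d_def)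
  then obtain s where s: "\<And>n. s n \<in> W"
    "\<And>n. rip (x - s n) (x - s n) < d + 1 / (real n + 1)" by metis
  \<comment> \<open>The midpoint \<open>?z\<close> lies in \<open>W\<close>, so its squared distance
    to \<open>x\<close> is at least \<open>d\<close>; the parallelogram law then bounds
    \<open>s i - s j\<close> by the excesses of both distances over \<open>d\<close>.\<close>
  have par: "rip (s i - s j) (s i - s j) \<le> 2 / (real i + 1) + 2 / (real j + 1)" for i j
  proof -
    let ?z = "(1/2) *\<^sub>R (s i + s j)"
    have z: "?z \<in> W"
      using subspace_scale[OF W(1) subspace_add[OF W(1) s(1) s(1)], of "of_real (1/2)"]
      unfolding scale_of_real .
    have "rip (s i - s j) (s i - s j) + 4 * rip (x - ?z) (x - ?z) =
      2 * rip (x - s i) (x - s i) + 2 * rip (x - s j) (x - s j)"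
      by (simp add: rip.diff_left rip.diff_right rip_add_left rip_add_right rip_scaleR_left
          rip_scaleR_right algebra_simps)
    then show ?thesis using d_le[OF z] s(2)[of i] s(2)[of j] by simp
  qed
  have "Cauchy s"
  proof (rule metric_CauchyI)
    fix e :: real assume e: "e > 0"
    obtain N :: nat where N: "4 / (m * e\<^sup>2) < real N" using reals_Archimedean2 by blast
    show "\<exists>N. \<forall>i\<ge>N. \<forall>j\<ge>N. dist (s i) (s j) < e"
    proof (intro exI allI impI)
      fix i j assume ij: "i \<ge> N" "j \<ge> N"
      have "m * (norm (s i - s j))\<^sup>2 \<le> 2 / (real i + 1) + 2 / (real j + 1)"
        using b(3) par order_trans by blast
      also have "\<dots> \<le> 2 / (real N + 1) + 2 / (real N + 1)"
        using ij by (intro add_mono divide_left_mono) auto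
      also have "\<dots> < m * e\<^sup>2"
      proof -
        have p: "m * e\<^sup>2 > 0" using b(1) e by simp
        have "4 < real N * (m * e\<^sup>2)" using N p by (simp only: pos_divide_less_eq)
        then have "4 < real N * (m * e\<^sup>2) + m * e\<^sup>2" using p by linarith
        then have "4 < (m * e\<^sup>2) * (real N + 1)" by (simp add: algebra_simps)
        then have "4 / (real N + 1) < m * e\<^sup>2" by (simp add: pos_divide_less_eq)
        then show ?thesis by simp
      qed
      finally have "(norm (s i - s j))\<^sup>2 < e\<^sup>2" using b(1) by simp
      then show "dist (s i) (s j) < e"
        unfolding dist_norm using e by (intro power2_less_imp_less[of _ e]) auto
    qed
  qed
  then obtain y where y: "s \<longlonglongrightarrow> y" using Cauchy_convergent convergent_def by blast
  have yW: "y \<in> W" using closed_sequentially[OF W(2)] s(1) y by blast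
  have min: "rip (x - y) (x - y) \<le> d"
  proof (rule LIMSEQ_le)
    show "(\<lambda>n. rip (x - s n) (x - s n)) \<longlonglongrightarrow> rip (x - y) (x - y)"
      by (intro rip.tendsto tendsto_intros y)
    show "(\<lambda>n. d + 1 / (real n + 1)) \<longlonglongrightarrow> d"
      using tendsto_add[OF tendsto_const LIMSEQ_inverse_real_of_nat, of d]
      by (simp add: inverse_eq_divide add.commute)
    show "\<exists>N. \<forall>n\<ge>N. rip (x - s n) (x - s n) \<le> d + 1 / (real n + 1)"
      using s(2) less_imp_le by blast
  qed
  have "rip (x - y) w = 0" if w: "w \<in> W" for w
  proof (cases "w = 0")
    case True
    then show ?thesis using rip_commute[of "x - y" 0] by simp
  next
    case False
    let ?t = "- rip (x - y) w / rip w w"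
    have p: "rip w w > 0" using False by (rule rip_pos)
    have "y - ?t *\<^sub>R w \<in> W"
      using subspace_diff[OF W(1) yW subspace_scale[OF W(1) w, of "of_real ?t"]]
      unfolding scale_of_real .
    then have "d \<le> rip (x - y + ?t *\<^sub>R w) (x - y + ?t *\<^sub>R w)"
      using d_le by (metis (no_types, lifting) add_diff_eq diff_add_eq diff_diff_eq2)
    also have "\<dots> = rip (x - y) (x - y) - (rip (x - y) w)\<^sup>2 / rip w w"
      unfolding rip_square_expand using p by (simp add: field_simps power2_eq_square)
    finally have "(rip (x - y) w)\<^sup>2 / rip w w \<le> 0" using min by simp
    then show ?thesis using p by (simp add: divide_le_0_iff)
  qed
  \<comment> \<open>Minimality was tested only along real multiples of \<open>w\<close>; stability
    of \<open>W\<close> under all scalars upgrades real orthogonality to orthogonality for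
    \<open>ip\<close>.\<close>
  then show ?thesis using yW ip_eq_0_if_rip_eq_0[OF W(1)] by blast
qed

text \<open>Uniqueness for the definite description: the difference of two candidates lies in
  \<open>W\<close> and is orthogonal to itself.\<close>

lemma orth_proj_eq:
  assumes "subspace W" "y \<in> W" "\<And>w. w \<in> W \<Longrightarrow> ip (x - y) w = 0"
  shows "orth_proj ip W x = y"
  unfolding orth_proj_def
proof (rule the_equality)
  fix z assume z: "z \<in> W \<and> (\<forall>w\<in>W. ip (x - z) w = 0)"
  then have "z - y \<in> W" using assms by (simp add: subspace_diff)
  then have "ip (x - y) (z - y) - ip (x - z) (z - y) = 0" using z assms by simp
  then have "ip (z - y) (z - y) = 0" by (simp flip: ip_diff_left)
  then have "rip (z - y) (z - y) = 0" by (simp add: ip_self)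
  then show "z = y" using rip_pos[of "z - y"] by fastforce
qed (use assms in blast)

lemma orth_proj_in: "closed_subspace smul W \<Longrightarrow> orth_proj ip W x \<in> W"
  and orth_proj_orth: "closed_subspace smul W \<Longrightarrow> w \<in> W \<Longrightarrow> ip (x - orth_proj ip W x) w = 0"
  using projection_exists[of W x] orth_proj_eq[of W _ x] unfolding closed_subspace_def
  by blast+

lemma orthonormal_f_system_orthogonal:
  assumes "orthonormal_f_system smul ip J V" "i \<in> J" "j \<in> J" "i \<noteq> j" "g \<in> V j" "w \<in> V i"
  shows "ip g w = 0"
  using assms orth_proj_orth[of "V i" w g] by (simp add: orthonormal_f_system_def)

text \<open>Trades projections for mutual orthogonality of the subspaces, the form in which the
  property is verified for newly constructed families.\<close>

lemma orthonormal_f_system_iff: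
  "orthonormal_f_system smul ip J V \<longleftrightarrow> (\<forall>j\<in>J. closed_subspace smul (V j)) \<and>
     (\<forall>i\<in>J. \<forall>j\<in>J. i \<noteq> j \<longrightarrow> (\<forall>g\<in>V j. \<forall>w\<in>V i. ip g w = 0))" (is "?L \<longleftrightarrow> ?R")
proof
  assume L: ?L
  have "ip g w = 0" if "i \<in> J" "j \<in> J" "i \<noteq> j" "g \<in> V j" "w \<in> V i" for i j g w
    using orthonormal_f_system_orthogonal[OF L that] .
  then show ?R using L by (simp add: orthonormal_f_system_def)
next
  assume R: ?R
  have "orth_proj ip (V i) g = (if i = j then g else 0)" if "i \<in> J" "j \<in> J" "g \<in> V j" for i j g
    by (rule orth_proj_eq)
      (use R that in \<open>auto simp: closed_subspace_def subspace_0 split: if_splits\<close>)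
  then show ?L using R by (simp add: orthonormal_f_system_def)
qed

lemma rip_sum_orthogonal:
  assumes "finite F" "\<And>i j. i \<in> F \<Longrightarrow> j \<in> F \<Longrightarrow> i \<noteq> j \<Longrightarrow> rip (g i) (g j) = 0"
  shows "rip (\<Sum>j\<in>F. g j) (\<Sum>j\<in>F. g j) = (\<Sum>j\<in>F. rip (g j) (g j))"
  using assms
proof (induction F rule: finite_induct)
  case (insert i F)
  have "rip (g i) (\<Sum>j\<in>F. g j) = 0"
    unfolding rip.sum_right using insert by (intro sum.neutral) auto
  then show ?case
    using insert rip_commute[of "g i" "\<Sum>j\<in>F. g j"] by (simp add: rip_add_left rip_add_right)
qed simp

text \<open>Pythagoras is an equality for the norm of \<open>ip\<close>; replacing that norm by the
  class norm on both sides costs the factors \<open>m / M\<close> and \<open>M / m\<close>.\<close>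

lemma orthonormal_f_system_norm_bounds:
  assumes "orthonormal_f_system smul ip J W"
  shows "\<exists>A>0. \<exists>B>0. \<forall>F g. finite F \<and> F \<subseteq> J \<and> (\<forall>j\<in>F. g j \<in> W j) \<longrightarrow>
    A * (\<Sum>j\<in>F. (norm (g j))\<^sup>2) \<le> (norm (\<Sum>j\<in>F. g j))\<^sup>2 \<and>
    (norm (\<Sum>j\<in>F. g j))\<^sup>2 \<le> B * (\<Sum>j\<in>F. (norm (g j))\<^sup>2)"
proof -
  obtain m M where b: "m > 0" "M > 0"
    "\<And>x. m * (norm x)\<^sup>2 \<le> rip x x" "\<And>x. rip x x \<le> M * (norm x)\<^sup>2"
    by (rule norm_bounds) blast
  show ?thesis
  proof (rule exI[of _ "m / M"], intro conjI, use b in simp,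
      rule exI[of _ "M / m"], intro conjI, use b in simp, intro allI impI)
    fix F g assume F: "finite F \<and> F \<subseteq> J \<and> (\<forall>j\<in>F. g j \<in> W j)"
    let ?s = "\<Sum>j\<in>F. g j"
    have eq: "rip ?s ?s = (\<Sum>j\<in>F. rip (g j) (g j))"
    proof (rule rip_sum_orthogonal)
      fix i j assume "i \<in> F" "j \<in> F" "i \<noteq> j"
      moreover from this have "i \<in> J" "j \<in> J" "g i \<in> W i" "g j \<in> W j"
        using F by auto
      ultimately have "ip (g i) (g j) = 0"
        using orthonormal_f_system_orthogonal[OF assms, of j i "g i" "g j"] by simp
      then show "rip (g i) (g j) = 0"
        unfolding rip_def using real_part_of_real[of 0] by simp
    qed (use F in blast)
    have "m * (\<Sum>j\<in>F. (norm (g j))\<^sup>2) \<le> M * (norm ?s)\<^sup>2"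
      using sum_mono[of F "\<lambda>j. m * (norm (g j))\<^sup>2" "\<lambda>j. rip (g j) (g j)"] b(3) b(4)[of ?s] eq
      by (simp add: sum_distrib_left)
    moreover have "m * (norm ?s)\<^sup>2 \<le> M * (\<Sum>j\<in>F. (norm (g j))\<^sup>2)"
      using sum_mono[of F "\<lambda>j. rip (g j) (g j)" "\<lambda>j. M * (norm (g j))\<^sup>2"] b(4) b(3)[of ?s] eq
      by (simp add: sum_distrib_left)
    ultimately show "m / M * (\<Sum>j\<in>F. (norm (g j))\<^sup>2) \<le> (norm ?s)\<^sup>2 \<and>
        (norm ?s)\<^sup>2 \<le> M / m * (\<Sum>j\<in>F. (norm (g j))\<^sup>2)"
      using b(1,2) by (simp add: field_simps)
  qed
qed

end

section \<open>Unconditional summability from square-sum bounds\<close>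

text \<open>Cauchy criterion along finite subsets: a block of \<open>f\<close> disjoint from a large
  \<open>H\<close> is controlled by the tail of the summable family \<open>a\<close>.\<close>

lemma summable_on_norm_sq:
  fixes f :: "'i \<Rightarrow> 'b::banach"
  assumes a: "a summable_on J" and nonneg: "\<And>j. j \<in> J \<Longrightarrow> 0 \<le> (a j :: real)" and B: "B > 0"
    and le: "\<And>F. finite F \<Longrightarrow> F \<subseteq> J \<Longrightarrow> (norm (sum f F))\<^sup>2 \<le> B * sum a F"
  shows "f summable_on J"
proof -
  have "\<exists>P. eventually P (finite_subsets_at_top J) \<and>
      (\<forall>F G. P F \<and> P G \<longrightarrow> dist (sum f F) (sum f G) < e)" if e: "e > 0" for e
  proof -
    \<comment> \<open>Chosen so that \<open>B * d\<close> is half of \<open>(e / 2)\<^sup>2\<close>,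
      which leaves a strict inequality.\<close>
    define d where "d = e\<^sup>2 / (8 * B)"
    have "d > 0" using e B by (simp add: d_def)
    then obtain H where H: "finite H" "H \<subseteq> J" "dist (sum a H) (infsum a J) \<le> d"
      using has_sum_finite_approximation[OF has_sum_infsum[OF a]] by blast
    have *: "dist (sum f F) (sum f H) < e / 2" if F: "finite F" "H \<subseteq> F" "F \<subseteq> J" for F
    proof -
      have "(norm (sum f (F - H)))\<^sup>2 \<le> B * sum a (F - H)"
        by (rule le) (use F in auto)
      also have "sum a (F - H) = sum a F - sum a H"
        by (rule sum_diff) (use F in auto)
      also have "\<dots> \<le> d"
        using finite_sum_le_infsum[OF a F(1,3)] nonneg H(3) by (simp add: dist_real_def)
      also have "B * d < (e / 2)\<^sup>2"
        using B e by (simp add: d_def power_divide)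
      finally have "(norm (sum f (F - H)))\<^sup>2 < (e / 2)\<^sup>2" using B by simp
      then have "norm (sum f (F - H)) < e / 2"
        by (rule power2_less_imp_less) (use e in simp)
      then show ?thesis using F by (simp add: dist_norm sum_diff)
    qed
    have "dist (sum f F) (sum f G) < e"
      if "finite F" "H \<subseteq> F" "F \<subseteq> J" "finite G" "H \<subseteq> G" "G \<subseteq> J" for F G
      using dist_triangle_half_l[OF *[of F] *[of G]] that by blast
    then show ?thesis
      by (intro exI[of _ "\<lambda>F. finite F \<and> H \<subseteq> F \<and> F \<subseteq> J"])
        (use H in \<open>auto simp: eventually_finite_subsets_at_top\<close>)
  qed
  then have "cauchy_filter (filtermap (sum f) (finite_subsets_at_top J))"
    by (simp add: cauchy_filter_metric_filtermap)
  then obtain L where "(sum f \<longlongrightarrow> L) (finite_subsets_at_top J)"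
    using complete_uniform[where S="UNIV :: 'b set"] complete_UNIV by (force simp add: filterlim_def)
  then show ?thesis
    unfolding summable_on_def has_sum_def by blast
qed

section \<open>Invertible operators and the transport of orthonormal bases\<close>

context equivalent_ip
begin

text \<open>The lower bound yields injectivity and, read backwards, the bound \<open>1 / k\<close>
  for the inverse.\<close>

lemma bounded_invertible_operatorI:
  fixes T :: "'a \<Rightarrow>\<^sub>L 'a"
  assumes lin: "\<And>c x. T (smul c x) = smul c (T x)"
    and "surj T" and k: "k > 0" "\<And>x. k * norm x \<le> norm (T x)"
  shows "bounded_invertible_operator smul T"
proof -
  have "inj T"
  proof (rule injI)
    fix x y assume "T x = T y"
    then have "k * norm (x - y) \<le> 0"
      using k(2)[of "x - y"] by (simp add: blinfun.diff_right)
    then show "x = y" using k(1) by (simp add: mult_le_0_iff)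
  qed
  obtain S where S: "\<And>x. T (S x) = x" using \<open>surj T\<close> by (metis surjD)
  have ST: "S (T x) = x" for x using S \<open>inj T\<close> by (metis injD)
  have add: "S (x + y) = S x + S y" for x y
    by (metis S ST blinfun.add_right)
  have scale: "S (smul c x) = smul c (S x)" for c x
    by (metis S ST lin)
  have "bounded_linear S"
  proof (rule bounded_linear_intro[where K="1 / k"])
    show "S (r *\<^sub>R x) = r *\<^sub>R S x" for r x
      using scale[of "of_real r" x] unfolding scale_of_real .
    show "norm (S x) \<le> norm x * (1 / k)" for x
      using k(2)[of "S x"] k(1) by (simp add: S field_simps)
  qed (rule add)
  then have "bounded_operator smul S"
    unfolding bounded_operator_def Vector_Spaces.linear_iff using vector_space_axioms add scale by blast
  moreover have "bounded_operator smul T"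
    unfolding bounded_operator_def Vector_Spaces.linear_iff
    using vector_space_axioms lin blinfun.add_right blinfun.bounded_linear_right by blast
  ultimately show ?thesis
    unfolding bounded_invertible_operator_def using S ST by (auto simp: fun_eq_iff)
qed

text \<open>Surjectivity and continuity of \<open>T\<close> send a dense span onto a dense
  span.\<close>

lemma complete_family_image:
  assumes T: "bounded_invertible_operator smul T" and V: "complete_family smul J V"
    and W: "\<And>j. j \<in> J \<Longrightarrow> W j = T ` V j"
  shows "complete_family smul J W"
proof -
  obtain S where S: "T \<circ> S = id" and lin: "Vector_Spaces.linear smul smul T" "bounded_linear T"
    using T unfolding bounded_invertible_operator_def bounded_operator_def by blast
  interpret T: Vector_Spaces.linear smul smul T by (rule lin)
  have "(\<Union>j\<in>J. W j) = T ` (\<Union>j\<in>J. V j)" using W by auto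
  then have eq: "span (\<Union>j\<in>J. W j) = T ` span (\<Union>j\<in>J. V j)" by (simp add: T.span_image)
  have "UNIV = T ` UNIV" using S by (metis comp_eq_dest_lhs id_apply surjI)
  also have "\<dots> = T ` closure (span (\<Union>j\<in>J. V j))"
    using V by (simp add: complete_family_def)
  also have "\<dots> \<subseteq> closure (span (\<Union>j\<in>J. W j))"
    unfolding eq
    by (rule continuous_image_closure_subset[OF linear_continuous_on[OF lin(2)] subset_UNIV])
  finally show ?thesis unfolding complete_family_def by blast
qed

text \<open>For the pulled back inner product \<open>T\<close> becomes unitary from
  \<open>ip\<close> to \<open>ip1\<close>, so it carries the orthogonality of the \<open>V j\<close>
  to the \<open>W j\<close>.\<close>

lemma equivalent_inner_product_pullback:
  assumes T: "bounded_invertible_operator smul T" and V: "orthonormal_f_basis smul ip J V"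
    and W: "\<And>j. j \<in> J \<Longrightarrow> T ` V j = W j" "\<And>j. j \<in> J \<Longrightarrow> closed_subspace smul (W j)"
  shows "\<exists>ip1. equivalent_inner_product smul ip1 \<and> orthonormal_f_basis smul ip1 J W"
proof -
  obtain S where S: "bounded_operator smul S" "\<And>x. S (T x) = x" "\<And>x. T (S x) = x"
    and bT: "bounded_linear T"
    using T unfolding bounded_invertible_operator_def bounded_operator_def fun_eq_iff by auto
  have bS: "bounded_linear S" using S(1) by (simp add: bounded_operator_def)
  have S_add: "S (x + y) = S x + S y" and S_scale: "S (smul c x) = smul c (S x)" for x y c
    using S(1) unfolding bounded_operator_def Vector_Spaces.linear_iff by blast+
  define ip1 where "ip1 x y = ip (S x) (S y)" for x y
  have "inner_product smul ip1"
    unfolding inner_product_def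
  proof (intro conjI allI impI)
    show "ip1 y x = conjugate (ip1 x y)" for x y
      unfolding ip1_def by (rule ip_commute)
    fix x :: 'a assume "x \<noteq> 0"
    then have "S x \<noteq> 0" using S(3)[of x] linear_0[OF bounded_linear.linear[OF bT]] by metis
    then show "\<exists>r>0. ip1 x x = of_real r"
      unfolding ip1_def using ip_self rip_pos by blast
  qed (simp_all add: ip1_def S_add S_scale ip_add_left ip_smul_left)
  moreover have "\<exists>m>0. \<exists>M>0. \<forall>f. m * norm f \<le> ip_norm ip1 f \<and> ip_norm ip1 f \<le> M * norm f"
  proof -
    obtain m M where b: "m > 0" "M > 0"
      "\<And>x. m * norm x \<le> ip_norm ip x" "\<And>x. ip_norm ip x \<le> M * norm x"
      using equivalent unfolding equivalent_inner_product_def by blast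
    obtain K where K: "K > 0" "\<And>x. norm (S x) \<le> norm x * K"
      using bounded_linear.pos_bounded[OF bS] by blast
    obtain L where L: "L > 0" "\<And>x. norm (T x) \<le> norm x * L"
      using bounded_linear.pos_bounded[OF bT] by blast
    have eq: "ip_norm ip1 f = ip_norm ip (S f)" for f
      by (simp add: ip_norm_def ip1_def)
    \<comment> \<open>Since \<open>f = T (S f)\<close>, the bound \<open>L\<close> of
      \<open>T\<close> limits how far \<open>S\<close> can shrink \<open>f\<close>.\<close>
    have "m / L * norm f \<le> ip_norm ip1 f" for f
    proof -
      have "m * norm f \<le> m * (norm (S f) * L)"
        using L(2)[of "S f"] b(1) by (simp add: S)
      also have "\<dots> \<le> ip_norm ip (S f) * L"
        using b(3)[of "S f"] L(1) by (simp flip: mult.assoc)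
      finally show ?thesis using L(1) by (simp add: eq field_simps)
    qed
    moreover have "ip_norm ip1 f \<le> M * K * norm f" for f
      using order_trans[OF b(4) mult_left_mono[OF K(2), of M]] b(2)
      by (simp add: eq mult.commute mult.left_commute)
    ultimately show ?thesis
      using b K(1) L(1) by (intro exI[of _ "m / L"] exI[of _ "M * K"] conjI) auto
  qed
  ultimately have ip1: "equivalent_inner_product smul ip1"
    unfolding equivalent_inner_product_def by blast
  interpret ip1: equivalent_ip smul ip1
    by unfold_locales (rule scale_of_real, rule ip1)
  have "ip1 g w = 0" if *: "i \<in> J" "j \<in> J" "i \<noteq> j" "g \<in> W j" "w \<in> W i" for i j g w
  proof -
    obtain g' w' where "g' \<in> V j" "g = T g'" "w' \<in> V i" "w = T w'"
      using * W(1) by blast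
    then show ?thesis
      using orthonormal_f_system_orthogonal[of J V i j g' w'] that V
      by (simp add: orthonormal_f_basis_def ip1_def S(2))
  qed
  then have "orthonormal_f_system smul ip1 J W"
    unfolding ip1.orthonormal_f_system_iff using W(2) by blast
  moreover have "complete_family smul J W"
    by (rule complete_family_image[OF T, of J V])
      (use V W(1) in \<open>auto simp: orthonormal_f_basis_def\<close>)
  ultimately show ?thesis
    using ip1 unfolding orthonormal_f_basis_def by blast
qed

text \<open>Elements of the operator type are only real-linear, so compatibility with
  \<open>smul\<close> is made part of the set.\<close>

definition symmetric_operators :: "('a \<Rightarrow>\<^sub>L 'a) set" where
  "symmetric_operators = {Y :: 'a \<Rightarrow>\<^sub>L 'a. (\<forall>c x. Y (smul c x) = smul c (Y x)) \<and> (\<forall>x y. rip (Y x) y = rip x (Y y))}"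

text \<open>Makes the intersection with a closed ball complete, so that the fixed point giving the
  square root is itself symmetric.\<close>

lemma closed_symmetric_operators: "closed symmetric_operators"
  unfolding symmetric_operators_def
  by (intro closed_Collect_conj closed_Collect_all closed_Collect_eq
      bounded_linear.continuous_on[OF bounded_linear_smul] rip.continuous_on
      blinfun.continuous_on continuous_on_const continuous_on_id)

end

section \<open>Square roots of positive operators\<close>

context separable_hilbert_space
begin

sublocale equivalent_ip smul ip
proof unfold_locales
  show "equivalent_inner_product smul ip"
    unfolding equivalent_inner_product_def
    using inner_product norm_eq_ip_norm by (auto intro!: exI[of _ 1])
qed (rule scale_of_real)

lemma rip_self: "rip x x = (norm x)\<^sup>2"
  by (simp add: norm_eq_ip_norm ip_norm_sq)

lemma rip_le: "\<bar>rip x y\<bar> \<le> norm x * norm y"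
  using rip_Cauchy_Schwarz by (simp add: norm_eq_ip_norm)

text \<open>The square root of \<open>1 - Q\<close> is \<open>1 - Y\<close> for the fixed point \<open>Y\<close> of the contraction
  \<open>Y \<mapsto> (Q + Y\<^sup>2) / 2\<close>; the radius \<open>r\<close> below is the scalar fixed point for \<open>norm Q\<close>.\<close>

lemma sqrt_fixed_point:
  fixes Q :: "'a \<Rightarrow>\<^sub>L 'a"
  assumes Q: "Q \<in> symmetric_operators" "norm Q < 1"
  shows "\<exists>Y :: 'a \<Rightarrow>\<^sub>L 'a. Y \<in> symmetric_operators \<and> norm Y < 1 \<and> (\<forall>x. 2 *\<^sub>R Y x = Q x + Y (Y x))"
proof -
  define r where "r = 1 - sqrt (1 - norm Q)"
  define f :: "('a \<Rightarrow>\<^sub>L 'a) \<Rightarrow> 'a \<Rightarrow>\<^sub>L 'a" where "f Y = (1/2) *\<^sub>R (Q + (Y o\<^sub>L Y))" for Y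
  have r: "0 \<le> r" "r < 1" "norm Q + r * r = 2 * r"
    using Q(2) by (auto simp: r_def algebra_simps)
  let ?C = "cball 0 r \<inter> symmetric_operators"
  have "\<exists>!Y\<in>?C. f Y = Y"
  proof (rule Banach_fix)
    show "complete ?C"
      by (simp add: complete_eq_closed closed_Int closed_symmetric_operators)
    have "0 \<in> ?C"
      using r by (simp add: symmetric_operators_def rip.zero_right)
    then show "?C \<noteq> {}" by blast
    show "f ` ?C \<subseteq> ?C"
    proof
      fix Z assume "Z \<in> f ` ?C"
      then obtain Y where Y: "Z = f Y" "norm Y \<le> r" "Y \<in> symmetric_operators" by auto
      have "norm (Q + (Y o\<^sub>L Y)) \<le> norm Q + norm Y * norm Y"
        by (rule norm_triangle_mono[OF order_refl norm_blinfun_compose])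
      also have "\<dots> \<le> norm Q + r * r"
        using mult_mono[OF Y(2) Y(2)] r by simp
      finally have "norm Z \<le> r" using r by (simp add: Y(1) f_def)
      moreover have "Z \<in> symmetric_operators"
        using Q(1) Y(3)
        by (auto simp: symmetric_operators_def Y(1) f_def blinfun.bilinear_simps scale_right_distrib
            smul_scaleR
            rip_add_left rip_add_right rip_scaleR_left rip_scaleR_right)
      ultimately show "Z \<in> ?C" by simp
    qed
    fix Y Z assume YZ: "Y \<in> ?C" "Z \<in> ?C"
    \<comment> \<open>A difference of squares split so as to respect that \<open>Y\<close> and
      \<open>Z\<close> need not commute; each summand contributes at most \<open>r / 2\<close> to
      the contraction constant.\<close>
    have "f Y - f Z = (1/2) *\<^sub>R ((Y o\<^sub>L (Y - Z)) + ((Y - Z) o\<^sub>L Z))"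
      by (rule blinfun_eqI) (simp add: f_def blinfun.bilinear_simps algebra_simps)
    then have "2 * norm (f Y - f Z) = norm ((Y o\<^sub>L (Y - Z)) + ((Y - Z) o\<^sub>L Z))"
      by simp
    also have "\<dots> \<le> norm Y * norm (Y - Z) + norm (Y - Z) * norm Z"
      by (rule norm_triangle_mono[OF norm_blinfun_compose norm_blinfun_compose])
    also have "\<dots> \<le> r * norm (Y - Z) + norm (Y - Z) * r"
      by (intro add_mono mult_left_mono mult_right_mono) (use YZ in auto)
    finally show "dist (f Y) (f Z) \<le> r * dist Y Z"
      by (simp add: dist_norm)
  qed (use r in auto)
  then obtain Y where Y: "Y \<in> symmetric_operators" "norm Y \<le> r" "f Y = Y" by auto
  have "2 *\<^sub>R Y x = Q x + Y (Y x)" for x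
    by (subst Y(3)[symmetric]) (simp add: f_def blinfun.bilinear_simps)
  then show ?thesis using Y r by auto
qed

text \<open>Rescaling writes \<open>S\<close> as \<open>c\<close> times \<open>1 - Q\<close> with
  \<open>norm Q < 1\<close>; the fixed point \<open>Y\<close> for \<open>Q\<close> gives the root
  \<open>sqrt c\<close> times \<open>1 - Y\<close>.\<close>

lemma sqrt_operator:
  fixes S :: "'a \<Rightarrow>\<^sub>L 'a"
  assumes S: "S \<in> symmetric_operators" and A: "A > 0" "\<And>x. A * (norm x)\<^sup>2 \<le> rip (S x) x"
  shows "\<exists>R :: 'a \<Rightarrow>\<^sub>L 'a. R \<in> symmetric_operators \<and> bounded_invertible_operator smul R \<and> (\<forall>x. R (R x) = S x)"
proof -
  \<comment> \<open>Adding \<open>A\<close> ensures \<open>K > 0\<close> and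
    \<open>A \<le> K\<close>, which keeps the radicand \<open>1 - A\<^sup>2 / K\<^sup>2\<close>
    nonnegative.\<close>
  define K where "K = norm S + A"
  \<comment> \<open>The squared norm of \<open>x - t *\<^sub>R S x\<close> is at most
    \<open>1 - 2 * t * A + t\<^sup>2 * K\<^sup>2\<close> times that of \<open>x\<close> for
    \<open>t \<ge> 0\<close>; this factor is smallest at \<open>t = A / K\<^sup>2\<close>, that is
    \<open>1 / c\<close>.\<close>
  define c where "c = K\<^sup>2 / A"
  define Q where "Q = id_blinfun - (1 / c) *\<^sub>R S"
  have K: "K > 0" "A \<le> K" using A by (simp_all add: K_def add_nonneg_pos)
  then have c: "c > 0" using A by (simp add: c_def)
  have Q: "Q \<in> symmetric_operators"
    using S
    by (auto simp: symmetric_operators_def Q_def blinfun.bilinear_simps scale_right_diff_distrib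
        smul_scaleR
        rip.diff_left rip.diff_right rip_scaleR_left rip_scaleR_right)
  have "(norm (Q x))\<^sup>2 \<le> (1 - A\<^sup>2 / K\<^sup>2) * (norm x)\<^sup>2" for x
  proof -
    have "norm (S x) \<le> K * norm x"
      using norm_blinfun[of S x] A(1) mult_right_mono[of "norm S" K "norm x"]
      by (simp add: K_def)
    then have "(norm (S x))\<^sup>2 \<le> K\<^sup>2 * (norm x)\<^sup>2"
      using power_mono[of "norm (S x)" "K * norm x" 2] by (simp add: power_mult_distrib)
    then have "(1 / c)\<^sup>2 * (norm (S x))\<^sup>2 \<le> (1 / c)\<^sup>2 * (K\<^sup>2 * (norm x)\<^sup>2)"
      by (rule mult_left_mono) simp
    moreover have "(1 / c)\<^sup>2 * (K\<^sup>2 * (norm x)\<^sup>2) = A\<^sup>2 / K\<^sup>2 * (norm x)\<^sup>2"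
      using A K by (simp add: c_def power_divide power2_eq_square)
    moreover have "2 / c * (A * (norm x)\<^sup>2) \<le> 2 / c * rip (S x) x"
      by (rule mult_left_mono[OF A(2)]) (use c in simp)
    moreover have "2 / c * (A * (norm x)\<^sup>2) = 2 * (A\<^sup>2 / K\<^sup>2 * (norm x)\<^sup>2)"
      using A K by (simp add: c_def power2_eq_square)
    moreover have "(norm (Q x))\<^sup>2 = (norm x)\<^sup>2 - 2 / c * rip (S x) x + (1 / c)\<^sup>2 * (norm (S x))\<^sup>2"
      using rip_square_expand[of x "- (1 / c)" "S x"]
      by (simp add: Q_def blinfun.bilinear_simps rip_self rip_commute[of x])
    ultimately show ?thesis by (simp add: left_diff_distrib)
  qed
  then have "norm (Q x) \<le> sqrt (1 - A\<^sup>2 / K\<^sup>2) * norm x" for x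
    by (metis norm_ge_zero real_le_rsqrt real_sqrt_abs abs_norm_cancel real_sqrt_mult)
  then have "norm Q \<le> sqrt (1 - A\<^sup>2 / K\<^sup>2)"
    by (intro norm_blinfun_bound) (use A K in \<open>auto simp: power_mono\<close>)
  also have "\<dots> < 1" using A K by simp
  finally obtain Y where Y: "Y \<in> symmetric_operators" "norm Y < 1"
    "\<And>x. 2 *\<^sub>R Y x = Q x + Y (Y x)"
    using sqrt_fixed_point[OF Q] by blast
  define R where "R = sqrt c *\<^sub>R (id_blinfun - Y)"
  have R_eq: "R x = sqrt c *\<^sub>R (x - Y x)" for x
    by (simp add: R_def blinfun.bilinear_simps)
  have R: "R \<in> symmetric_operators"
    using Y(1)
    by (auto simp: symmetric_operators_def R_eq scale_right_diff_distrib
        smul_scaleR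
        rip.diff_left rip.diff_right rip_scaleR_left rip_scaleR_right)
  have "R (R x) = S x" for x
  proof -
    have "R (R x) = c *\<^sub>R (x - 2 *\<^sub>R Y x + Y (Y x))"
      using c by (simp add: R_eq blinfun.bilinear_simps algebra_simps scaleR_2)
    also have "x - 2 *\<^sub>R Y x + Y (Y x) = (1 / c) *\<^sub>R S x"
      by (simp add: Y(3) Q_def blinfun.bilinear_simps)
    finally show ?thesis using c by simp
  qed
  moreover have "bounded_invertible_operator smul R"
  proof (rule bounded_invertible_operatorI)
    show "R (smul c x) = smul c (R x)" for c x
      using R by (simp add: symmetric_operators_def)
    show "sqrt c * (1 - norm Y) > 0" using c Y(2) by simp
    show "sqrt c * (1 - norm Y) * norm x \<le> norm (R x)" for x
    proof -
      have "(1 - norm Y) * norm x \<le> norm (x - Y x)"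
        using norm_triangle_ineq2[of x "Y x"] norm_blinfun[of Y x] by (simp add: algebra_simps)
      then show ?thesis using c by (simp add: R_eq mult.assoc)
    qed
    have "\<exists>x. z = R x" for z
    proof -
      \<comment> \<open>Solving \<open>R x = z\<close> amounts to a fixed point equation whose map
        contracts because \<open>norm Y < 1\<close>.\<close>
      have "\<exists>!x. (1 / sqrt c) *\<^sub>R z + Y x = x"
      proof (rule banach_fix_type[OF norm_ge_zero Y(2)], intro allI)
        show "dist ((1 / sqrt c) *\<^sub>R z + Y x) ((1 / sqrt c) *\<^sub>R z + Y y) \<le> norm Y * dist x y" for x y
          using norm_blinfun[of Y "x - y"] by (simp add: dist_norm blinfun.diff_right)
      qed
      then obtain x where "(1 / sqrt c) *\<^sub>R z + Y x = x" by blast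
      then have "x - Y x = (1 / sqrt c) *\<^sub>R z" by (metis add_diff_cancel_right')
      then have "R x = z" using c by (simp add: R_eq)
      then show ?thesis by blast
    qed
    then show "surj R" by (simp add: surj_def)
  qed
  ultimately show ?thesis using R by blast
qed

end

section \<open>The frame operator\<close>

locale riesz_family = separable_hilbert_space smul ip
  for smul :: "'k::real_or_complex \<Rightarrow> 'a::banach \<Rightarrow> 'a" and ip +
  fixes J :: "'i set" and W :: "'i \<Rightarrow> 'a set" and A B :: real
  assumes closed: "j \<in> J \<Longrightarrow> closed_subspace smul (W j)"
    and complete: "complete_family smul J W"
    and pos: "A > 0" "B > 0"
    and lower: "finite F \<Longrightarrow> F \<subseteq> J \<Longrightarrow> (\<And>j. j \<in> F \<Longrightarrow> g j \<in> W j) \<Longrightarrow>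
      A * (\<Sum>j\<in>F. (norm (g j))\<^sup>2) \<le> (norm (\<Sum>j\<in>F. g j))\<^sup>2"
    and upper: "finite F \<Longrightarrow> F \<subseteq> J \<Longrightarrow> (\<And>j. j \<in> F \<Longrightarrow> g j \<in> W j) \<Longrightarrow>
      (norm (\<Sum>j\<in>F. g j))\<^sup>2 \<le> B * (\<Sum>j\<in>F. (norm (g j))\<^sup>2)"
begin

definition proj :: "'i \<Rightarrow> 'a \<Rightarrow> 'a" where
  "proj j = orth_proj ip (W j)"

lemma subspace_W: "j \<in> J \<Longrightarrow> subspace (W j)"
  using closed by (simp add: closed_subspace_def)

lemma proj_in: "j \<in> J \<Longrightarrow> proj j x \<in> W j"
  unfolding proj_def by (intro orth_proj_in closed)

lemma proj_orth: "j \<in> J \<Longrightarrow> w \<in> W j \<Longrightarrow> ip (x - proj j x) w = 0"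
  unfolding proj_def by (intro orth_proj_orth closed)

lemma rip_proj: "j \<in> J \<Longrightarrow> w \<in> W j \<Longrightarrow> rip (proj j x) w = rip x w"
  using proj_orth[of j w x] real_part_of_real[of 0]
  by (metis eq_iff_diff_eq_0 of_real_0 rip.diff_left rip_def)

lemma proj_add: "j \<in> J \<Longrightarrow> proj j (x + y) = proj j x + proj j y"
  unfolding proj_def[of j]
proof (rule orth_proj_eq)
  assume j: "j \<in> J"
  show "subspace (W j)" using j by (rule subspace_W)
  show "orth_proj ip (W j) x + orth_proj ip (W j) y \<in> W j"
    using subspace_add[OF subspace_W proj_in proj_in] j by (simp add: proj_def)
  show "ip (x + y - (orth_proj ip (W j) x + orth_proj ip (W j) y)) w = 0" if "w \<in> W j" for w
    using proj_orth[OF j that, of x] proj_orth[OF j that, of y]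
    by (simp add: proj_def add_diff_add ip_add_left)
qed

lemma proj_smul: "j \<in> J \<Longrightarrow> proj j (smul c x) = smul c (proj j x)"
  unfolding proj_def[of j]
proof (rule orth_proj_eq)
  assume j: "j \<in> J"
  show "subspace (W j)" using j by (rule subspace_W)
  show "smul c (orth_proj ip (W j) x) \<in> W j"
    using subspace_scale[OF subspace_W proj_in] j by (simp add: proj_def)
  show "ip (smul c x - smul c (orth_proj ip (W j) x)) w = 0" if "w \<in> W j" for w
    using proj_orth[OF j that, of x]
    by (simp add: proj_def ip_smul_left flip: scale_right_diff_distrib)
qed

lemma rip_proj_self: "j \<in> J \<Longrightarrow> rip (proj j x) x = (norm (proj j x))\<^sup>2"
  using rip_proj[of j "proj j x" x] proj_in[of j x] by (simp add: rip_self rip_commute[of _ x])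

lemma upper_proj:
  assumes "finite F" "F \<subseteq> J"
  shows "(norm (\<Sum>j\<in>F. proj j x))\<^sup>2 \<le> B * (\<Sum>j\<in>F. (norm (proj j x))\<^sup>2)"
  by (rule upper) (use assms in \<open>auto intro: proj_in\<close>)

text \<open>The sum is the inner product of its vector counterpart with \<open>x\<close>.
  Cauchy-Schwarz and the upper bound give
  \<open>?\<sigma>\<^sup>2 \<le> B * ?\<sigma> * (norm x)\<^sup>2\<close>, and one factor
  cancels.\<close>

lemma bessel:
  assumes F: "finite F" "F \<subseteq> J"
  shows "(\<Sum>j\<in>F. (norm (proj j x))\<^sup>2) \<le> B * (norm x)\<^sup>2" (is "?\<sigma> \<le> _")
proof (cases "?\<sigma> = 0")
  case True
  then show ?thesis using pos by simp
next
  case False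
  then have p: "?\<sigma> > 0" by (simp add: order_less_le sum_nonneg)
  have "?\<sigma> = rip (\<Sum>j\<in>F. proj j x) x"
    unfolding rip.sum_left by (rule sum.cong) (use F in \<open>auto simp: rip_proj_self\<close>)
  also have "\<dots> \<le> norm (\<Sum>j\<in>F. proj j x) * norm x"
    using rip_le by (rule abs_le_D1)
  finally have "?\<sigma>\<^sup>2 \<le> (norm (\<Sum>j\<in>F. proj j x))\<^sup>2 * (norm x)\<^sup>2"
    unfolding power_mult_distrib[symmetric] by (rule power_mono) (use p in simp)
  also have "\<dots> \<le> B * ?\<sigma> * (norm x)\<^sup>2"
    by (rule mult_right_mono[OF upper_proj[OF F]]) simp
  finally have "?\<sigma> * ?\<sigma> \<le> ?\<sigma> * (B * (norm x)\<^sup>2)"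
    by (simp add: power2_eq_square mult_ac)
  then show ?thesis using p by simp
qed

lemma summable_norm_sq: "(\<lambda>j. (norm (proj j x))\<^sup>2) summable_on J"
  by (rule nonneg_bdd_above_summable_on)
    (use bessel in \<open>auto intro!: bdd_aboveI2\<close>)

definition frame :: "'a \<Rightarrow> 'a" where
  "frame x = infsum (\<lambda>j. proj j x) J"

lemma has_sum_frame: "((\<lambda>j. proj j x) has_sum frame x) J"
  unfolding frame_def
  by (rule has_sum_infsum, rule summable_on_norm_sq[OF summable_norm_sq _ pos(2) upper_proj]) simp_all

text \<open>Projections are idempotent and self-adjoint. The symmetric form of the terms gives the
  symmetry of \<open>frame\<close>, and for \<open>y = x\<close> the terms are squared
  norms.\<close>

lemma has_sum_rip_frame: "((\<lambda>j. rip (proj j x) (proj j y)) has_sum rip (frame x) y) J"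
proof -
  have "((\<lambda>j. rip (proj j x) y) has_sum rip (frame x) y) J"
    by (rule has_sum_bounded_linear[OF rip.bounded_linear_left has_sum_frame])
  also have "?this \<longleftrightarrow> ?thesis"
    by (rule has_sum_cong) (metis proj_in rip_commute rip_proj)
  finally show ?thesis .
qed

lemma frame_bounded: "norm (frame x) \<le> B * norm x"
proof -
  have "norm (sum (\<lambda>j. proj j x) F) \<le> B * norm x" if F: "finite F" "F \<subseteq> J" for F
  proof (rule power2_le_imp_le)
    \<comment> \<open>The upper bound and \<open>bessel\<close> contribute one factor
      \<open>B\<close> each.\<close>
    show "(norm (sum (\<lambda>j. proj j x) F))\<^sup>2 \<le> (B * norm x)\<^sup>2"
      using order_trans[OF upper_proj[OF F] mult_left_mono[OF bessel[OF F]], of x] pos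
      by (simp add: power_mult_distrib power2_eq_square mult_ac)
  qed (use pos in simp)
  then show ?thesis
    using has_sum_frame[of x] unfolding has_sum_def
    by (intro tendsto_upperbound[OF tendsto_norm]) auto
qed

lemma frame_smul: "frame (smul c x) = smul c (frame x)"
proof (rule has_sum_unique[OF has_sum_frame])
  have "((\<lambda>j. smul c (proj j x)) has_sum smul c (frame x)) J"
    by (rule has_sum_bounded_linear[OF bounded_linear_smul has_sum_frame])
  then show "((\<lambda>j. proj j (smul c x)) has_sum smul c (frame x)) J"
    by (rule has_sum_cong[THEN iffD1, rotated]) (simp add: proj_smul)
qed

lemma frame_add: "frame (x + y) = frame x + frame y"
proof (rule has_sum_unique[OF has_sum_frame])
  show "((\<lambda>j. proj j (x + y)) has_sum (frame x + frame y)) J"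
    by (rule has_sum_cong[THEN iffD1, rotated, OF has_sum_add[OF has_sum_frame has_sum_frame]])
      (simp add: proj_add)
qed

lemma bounded_linear_frame: "bounded_linear frame"
proof (rule bounded_linear_intro)
  show "frame (r *\<^sub>R x) = r *\<^sub>R frame x" for r x
    using frame_smul[of "of_real r" x] unfolding scale_of_real .
  show "norm (frame x) \<le> norm x * B" for x
    using frame_bounded by (simp add: mult.commute)
qed (rule frame_add)

lemma frame_symmetric: "rip (frame x) y = rip x (frame y)"
proof -
  have "(\<lambda>j. rip (proj j y) (proj j x)) = (\<lambda>j. rip (proj j x) (proj j y))"
    by (rule ext) (rule rip_commute)
  then show ?thesis
    using has_sum_unique[OF has_sum_rip_frame[of x y]] has_sum_rip_frame[of y x]
    by (metis rip_commute)
qed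

section \<open>Coercivity of the frame operator and uniqueness of expansions\<close>

lemma span_eq_sum:
  assumes "x \<in> span (\<Union>j\<in>J. W j)"
  shows "\<exists>F g. finite F \<and> F \<subseteq> J \<and> (\<forall>j\<in>J. g j \<in> W j) \<and> x = (\<Sum>j\<in>F. g j)"
proof -
  \<comment> \<open>Requiring \<open>g\<close> to vanish outside \<open>F\<close> allows two
    representations to be added over the union of their index sets.\<close>
  let ?D = "{x. \<exists>F g. finite F \<and> F \<subseteq> J \<and> (\<forall>j\<in>J. g j \<in> W j) \<and> (\<forall>j. j \<notin> F \<longrightarrow> g j = 0) \<and>
    x = (\<Sum>j\<in>F. g j)}"
  have "subspace ?D"
    unfolding subspace_def
  proof (intro conjI ballI allI)
    show "0 \<in> ?D"
      using subspace_0[OF subspace_W] by (auto intro!: exI[of _ "{}"] exI[of _ "\<lambda>_. 0"])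
  next
    fix x y assume "x \<in> ?D" "y \<in> ?D"
    then obtain F g G h where F: "finite F" "F \<subseteq> J" "\<forall>j\<in>J. g j \<in> W j" "\<forall>j. j \<notin> F \<longrightarrow> g j = 0"
      "x = (\<Sum>j\<in>F. g j)" and G: "finite G" "G \<subseteq> J" "\<forall>j\<in>J. h j \<in> W j"
      "\<forall>j. j \<notin> G \<longrightarrow> h j = 0" "y = (\<Sum>j\<in>G. h j)"
      by auto
    have "x = (\<Sum>j\<in>F \<union> G. g j)" "y = (\<Sum>j\<in>F \<union> G. h j)"
      unfolding F(5) G(5) using F G by (auto intro!: sum.mono_neutral_left)
    then have "x + y = (\<Sum>j\<in>F \<union> G. g j + h j)" by (simp add: sum.distrib)
    then show "x + y \<in> ?D"
      using F G subspace_add[OF subspace_W]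
      by (auto intro!: exI[of _ "F \<union> G"] exI[of _ "\<lambda>j. g j + h j"])
  next
    fix c x assume "x \<in> ?D"
    then obtain F g where F: "finite F" "F \<subseteq> J" "\<forall>j\<in>J. g j \<in> W j" "\<forall>j. j \<notin> F \<longrightarrow> g j = 0"
      "x = (\<Sum>j\<in>F. g j)" by auto
    then show "smul c x \<in> ?D"
      using subspace_scale[OF subspace_W]
      by (auto intro!: exI[of _ F] exI[of _ "\<lambda>j. smul c (g j)"] simp: scale_sum_right)
  qed
  moreover have "(\<Union>j\<in>J. W j) \<subseteq> ?D"
  proof
    fix x assume "x \<in> (\<Union>j\<in>J. W j)"
    then obtain i where "i \<in> J" "x \<in> W i" by blast
    then show "x \<in> ?D"
      using subspace_0[OF subspace_W]
      by (auto intro!: exI[of _ "{i}"] exI[of _ "\<lambda>j. if j = i then x else 0"] split: if_splits)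
  qed
  ultimately have "x \<in> ?D"
    by (intro subsetD[OF span_minimal assms])
  then show ?thesis by auto
qed

text \<open>Expand one copy of \<open>x\<close> in \<open>rip x x\<close> as the sum of the
  \<open>g j\<close> and move each projection onto the other copy. A weighted AM-GM inequality then
  produces \<open>A\<close> times the square sum of the \<open>g j\<close>, which the lower bound
  absorbs into \<open>(norm x)\<^sup>2\<close>.\<close>

lemma frame_lower_span:
  assumes "x \<in> span (\<Union>j\<in>J. W j)"
  shows "A * (norm x)\<^sup>2 \<le> rip (frame x) x"
proof -
  obtain F g where F: "finite F" "F \<subseteq> J" "\<forall>j\<in>J. g j \<in> W j" "x = (\<Sum>j\<in>F. g j)"
    using span_eq_sum[OF assms] by blast
  have amgm: "2 * rip (g j) x \<le> A * (norm (g j))\<^sup>2 + (norm (proj j x))\<^sup>2 / A" if "j \<in> F" for j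
  proof -
    have "rip (g j) x = rip (proj j x) (g j)"
      using rip_proj[of j "g j" x] that F by (auto simp: rip_commute[of "g j"])
    also have "\<dots> \<le> norm (proj j x) * norm (g j)" using rip_le by (rule abs_le_D1)
    finally have "A * (2 * rip (g j) x) \<le> A * (2 * (norm (proj j x) * norm (g j)))"
      using pos by simp
    also have "\<dots> \<le> (A * norm (g j))\<^sup>2 + (norm (proj j x))\<^sup>2"
      using zero_le_power2[of "A * norm (g j) - norm (proj j x)"]
      by (simp add: power2_eq_square algebra_simps)
    finally show ?thesis using pos by (simp add: field_simps power2_eq_square)
  qed
  have "2 * (norm x)\<^sup>2 = (\<Sum>j\<in>F. 2 * rip (g j) x)"
    unfolding rip_self[symmetric] sum_distrib_left[symmetric] rip.sum_left[symmetric]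
    by (simp only: F(4)[symmetric])
  also have "\<dots> \<le> (\<Sum>j\<in>F. A * (norm (g j))\<^sup>2 + (norm (proj j x))\<^sup>2 / A)"
    by (rule sum_mono) (rule amgm)
  also have "\<dots> = A * (\<Sum>j\<in>F. (norm (g j))\<^sup>2) + (\<Sum>j\<in>F. (norm (proj j x))\<^sup>2) / A"
    by (simp add: sum.distrib sum_distrib_left sum_divide_distrib)
  also have "\<dots> \<le> (norm x)\<^sup>2 + rip (frame x) x / A"
  proof (rule add_mono)
    show "A * (\<Sum>j\<in>F. (norm (g j))\<^sup>2) \<le> (norm x)\<^sup>2"
      using lower[of F g] F by auto
    show "(\<Sum>j\<in>F. (norm (proj j x))\<^sup>2) / A \<le> rip (frame x) x / A"
      using finite_sum_le_has_sum[OF has_sum_rip_frame[of x x] F(1,2)] pos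
      by (simp add: rip_self divide_right_mono)
  qed
  finally show ?thesis using pos by (simp add: field_simps)
qed

lemma frame_lower: "A * (norm x)\<^sup>2 \<le> rip (frame x) x"
proof -
  have "closed {x. A * (norm x)\<^sup>2 \<le> rip (frame x) x}"
    by (intro closed_Collect_le continuous_intros rip.continuous_on
        bounded_linear.continuous_on[OF bounded_linear_frame])
  then have "closure (span (\<Union>j\<in>J. W j)) \<subseteq> {x. A * (norm x)\<^sup>2 \<le> rip (frame x) x}"
    by (rule closure_minimal[rotated]) (use frame_lower_span in blast)
  then show ?thesis
    using complete unfolding complete_family_def by blast
qed

text \<open>The lower bound makes expansions in the \<open>W j\<close> unique, so if \<open>frame z\<close> lies in \<open>W i\<close> then
  its expansion \<open>(\<Sum>j. proj j z)\<close> reduces to the \<open>i\<close>-th term.\<close>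

lemma proj_eq_0_if_frame_mem:
  assumes z: "frame z \<in> W i" and i: "i \<in> J" and k: "k \<in> J" "k \<noteq> i"
  shows "proj k z = 0"
proof -
  \<comment> \<open>Over any finite \<open>F\<close> containing \<open>i\<close> the
    \<open>h j\<close> sum to the partial sum minus \<open>frame z\<close>, which tends to zero,
    while the term at \<open>k\<close> remains \<open>proj k z\<close>; the lower bound compares the
    two.\<close>
  define h where "h j = proj j z - (if j = i then frame z else 0)" for j
  have "((\<lambda>F. (norm ((\<Sum>j\<in>F. proj j z) - frame z))\<^sup>2) \<longlongrightarrow> (norm (frame z - frame z))\<^sup>2)
      (finite_subsets_at_top J)"
    using has_sum_frame[of z] unfolding has_sum_def by (intro tendsto_intros)
  moreover have "\<forall>\<^sub>F F in finite_subsets_at_top J.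
      A * (norm (proj k z))\<^sup>2 \<le> (norm ((\<Sum>j\<in>F. proj j z) - frame z))\<^sup>2"
    unfolding eventually_finite_subsets_at_top
  proof (intro exI[of _ "{i, k}"] conjI allI impI)
    fix F assume F: "finite F \<and> {i, k} \<subseteq> F \<and> F \<subseteq> J"
    have "(norm (proj k z))\<^sup>2 = (norm (h k))\<^sup>2" using k by (simp add: h_def)
    also have "\<dots> \<le> (\<Sum>j\<in>F. (norm (h j))\<^sup>2)"
      by (rule member_le_sum) (use F in auto)
    finally have "A * (norm (proj k z))\<^sup>2 \<le> A * (\<Sum>j\<in>F. (norm (h j))\<^sup>2)"
      using pos by simp
    also have "\<dots> \<le> (norm (\<Sum>j\<in>F. h j))\<^sup>2"
    proof (rule lower)
      fix j assume "j \<in> F"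
      then have "j \<in> J" using F by blast
      then show "h j \<in> W j"
        using z proj_in subspace_diff[OF subspace_W] by (auto simp: h_def)
    qed (use F in auto)
    also have "(\<Sum>j\<in>F. h j) = (\<Sum>j\<in>F. proj j z) - frame z"
      using F by (simp add: h_def sum_subtractf)
    finally show "A * (norm (proj k z))\<^sup>2 \<le> (norm ((\<Sum>j\<in>F. proj j z) - frame z))\<^sup>2" .
  qed (use i k in auto)
  ultimately have "A * (norm (proj k z))\<^sup>2 \<le> (norm (frame z - frame z))\<^sup>2"
    by (rule tendsto_lowerbound) simp
  then show ?thesis using pos by (simp add: mult_le_0_iff)
qed

lemma riesz_f_basis: "riesz_f_basis smul ip J W"
proof -
  have frame: "blinfun_apply (Blinfun frame) = frame"
    by (rule bounded_linear_Blinfun_apply[OF bounded_linear_frame])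
  have "Blinfun frame \<in> symmetric_operators"
    by (simp add: symmetric_operators_def frame frame_smul frame_symmetric)
  then obtain R :: "'a \<Rightarrow>\<^sub>L 'a" where R: "R \<in> symmetric_operators"
    "bounded_invertible_operator smul R" "\<And>x. R (R x) = frame x"
    using sqrt_operator[of "Blinfun frame" A] pos frame_lower unfolding frame by blast
  obtain S where S: "bounded_operator smul S" "\<And>x. S (R x) = x" "\<And>x. R (S x) = x"
    using R(2) unfolding bounded_invertible_operator_def fun_eq_iff by auto
  have S_inv: "bounded_invertible_operator smul S"
    using R(2) S unfolding bounded_invertible_operator_def fun_eq_iff by auto
  have S_sym: "rip (S x) y = rip x (S y)" for x y
    using R(1) S(3) unfolding symmetric_operators_def by (metis (mono_tags, lifting) mem_Collect_eq)
  define V where "V j = S ` W j" for j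
  \<comment> \<open>As preimages under the continuous linear \<open>R\<close>, the
    \<open>V j\<close> inherit closedness and the subspace property.\<close>
  have V_eq: "V j = R -` W j" for j
    by (auto simp: V_def S(3) intro: image_eqI[where f = S, OF S(2)[symmetric]])
  have linR: "Vector_Spaces.linear smul smul R"
    using R(2) by (simp add: bounded_invertible_operator_def bounded_operator_def)
  interpret R: Vector_Spaces.linear smul smul R by (rule linR)
  have V: "closed_subspace smul (V j)" if "j \<in> J" for j
    using closed[OF that] unfolding closed_subspace_def V_eq
    by (auto intro!: R.subspace_vimage closed_vimage blinfun.continuous_on continuous_on_const continuous_on_id)
  have "ip g w = 0" if *: "i \<in> J" "j \<in> J" "i \<noteq> j" "g \<in> V j" "w \<in> V i" for i j g w
  proof (rule ip_eq_0_if_rip_eq_0[of "V i"])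
    show "subspace (V i)" using V[OF *(1)] by (simp add: closed_subspace_def)
    fix w assume "w \<in> V i"
    then obtain w' where w': "w' \<in> W i" "w = S w'" by (auto simp: V_def)
    have g: "R g \<in> W j" using *(4) by (simp add: V_eq)
    \<comment> \<open>Here \<open>frame (S g) = R g\<close> lies in \<open>W j\<close>, so
      uniqueness of expansions annihilates the component of \<open>S g\<close> in
      \<open>W i\<close>.\<close>
    have "rip g w = rip (S g) w'" by (simp add: w' S_sym)
    also have "\<dots> = rip (proj i (S g)) w'" using rip_proj[OF *(1) w'(1)] by simp
    also have "proj i (S g) = 0"
      by (rule proj_eq_0_if_frame_mem[OF _ *(2,1,3)]) (simp add: g S flip: R(3))
    finally show "rip g w = 0" by simp
  qed (rule *)
  then have "orthonormal_f_system smul ip J V"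
    unfolding orthonormal_f_system_iff using V by blast
  moreover have "complete_family smul J V"
    by (rule complete_family_image[OF S_inv complete]) (simp add: V_def)
  moreover have "R ` V j = W j" for j
    by (simp add: V_def image_image S)
  ultimately show ?thesis
    unfolding riesz_f_basis_def orthonormal_f_basis_def using R(2) by blast
qed

end

theorem theorem3p14:
  fixes smul :: "'k::real_or_complex \<Rightarrow> 'a::banach \<Rightarrow> 'a"
    and ip :: "'a \<Rightarrow> 'a \<Rightarrow> 'k"
    and J :: "'i set"
    and W :: "'i \<Rightarrow> 'a set"
  assumes "separable_hilbert_space smul ip"
    and "countable J"
    and "\<And>j. j \<in> J \<Longrightarrow> closed_subspace smul (W j)"
  shows "(riesz_f_basis smul ip J W \<longleftrightarrow>
            (\<exists>ip1. equivalent_inner_product smul ip1 \<and> orthonormal_f_basis smul ip1 J W)) \<and>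
         ((\<exists>ip1. equivalent_inner_product smul ip1 \<and> orthonormal_f_basis smul ip1 J W) \<longleftrightarrow>
            complete_family smul J W \<and>
            (\<exists>A>0. \<exists>B>0. \<forall>F g. finite F \<and> F \<subseteq> J \<and> (\<forall>j\<in>F. g j \<in> W j) \<longrightarrow>
               A * (\<Sum>j\<in>F. (norm (g j))\<^sup>2) \<le> (norm (\<Sum>j\<in>F. g j))\<^sup>2 \<and>
               (norm (\<Sum>j\<in>F. g j))\<^sup>2 \<le> B * (\<Sum>j\<in>F. (norm (g j))\<^sup>2)))"
    (is "(?i \<longleftrightarrow> ?ii) \<and> (?ii \<longleftrightarrow> ?complete \<and> ?bounds)")
proof -
  interpret separable_hilbert_space smul ip by (rule assms)
  have "?ii" if ?i
    using that equivalent_inner_product_pullback[of _ J _ W] assms(3)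
    unfolding riesz_f_basis_def by blast
  moreover have "?complete \<and> ?bounds" if ?ii
  proof -
    obtain ip1 where ip1: "equivalent_inner_product smul ip1" "orthonormal_f_basis smul ip1 J W"
      using \<open>?ii\<close> by blast
    \<comment> \<open>Orthogonality is taken for \<open>ip1\<close>, whereas the resulting bounds
      are stated in the original norm.\<close>
    interpret ip1: equivalent_ip smul ip1
      by unfold_locales (rule scale_of_real, rule ip1)
    show ?thesis
      using ip1(2) ip1.orthonormal_f_system_norm_bounds unfolding orthonormal_f_basis_def by blast
  qed
  moreover have ?i if c: "?complete \<and> ?bounds"
  proof -
    obtain A B where AB: "A > 0" "B > 0" "\<forall>F g. finite F \<and> F \<subseteq> J \<and> (\<forall>j\<in>F. g j \<in> W j) \<longrightarrow>
        A * (\<Sum>j\<in>F. (norm (g j))\<^sup>2) \<le> (norm (\<Sum>j\<in>F. g j))\<^sup>2 \<and>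
        (norm (\<Sum>j\<in>F. g j))\<^sup>2 \<le> B * (\<Sum>j\<in>F. (norm (g j))\<^sup>2)"
      using c by blast
    interpret riesz_family smul ip J W A B
      by unfold_locales (use assms(3) c AB in auto)
    show ?thesis by (rule riesz_f_basis)
  qed
  ultimately show ?thesis by blast
qed

end
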